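(* Let $q$ be a prime power and let $V$ and $W$ be vector spaces over the finite field $\mathbb{F}_q$ of dimensions $m$ and $n$, respectively. The number $\mathcal{N}_{m,n}$ of nilpotent pairs $(f,g)$ of linear maps $f:V\to W$, $g:W\to V$ is $$\mathcal{N}_{m,n}=\sum_{r=0}^{\min\{m,n\}} \genfrac{[}{]}{0pt}{}{m}{r}_{q}\,\genfrac{[}{]}{0pt}{}{n}{r}_{q}\; q^{mn-r}\prod_{i=0}^{r-1}(q^r-q^i),$$ where for $r=0$ the product $\prod_{i=0}^{r-1}(q^r-q^i)$ is defined to be $1$.
   Context: A pair $(f,g)$ of linear maps $f:V\to W$, $g:W\to V$ is a nilpotent pair if $gf\in \mathrm{End}(V)$ is nilpotent (equivalently, $fg\in\mathrm{End}(W)$ is nilpotent). The $q$-binomial coefficient is $\genfrac{[}{]}{0pt}{}{m}{r}_{q}=\prod_{i=0}^{r-1}(q^m-q^i)\big/\prod_{i=0}^{r-1}(q^r-q^i)$, with empty products equal to $1$. *)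

theory Defs
  imports Complex_Main "HOL-Number_Theory.Prime_Powers"
begin

text \<open>The exponent 0 is allowed; it makes a difference only on the zero space, where the identity
  is the zero map.\<close>

definition nilpotent_map :: "('v::zero \<Rightarrow> 'v) \<Rightarrow> bool" where
  "nilpotent_map h \<longleftrightarrow> (\<exists>k. h ^^ k = (\<lambda>_. 0))"

definition nilpotent_pair ::
  "('k::field \<Rightarrow> 'v::ab_group_add \<Rightarrow> 'v) \<Rightarrow> ('k \<Rightarrow> 'w::ab_group_add \<Rightarrow> 'w) \<Rightarrow>
   ('v \<Rightarrow> 'w) \<Rightarrow> ('w \<Rightarrow> 'v) \<Rightarrow> bool" where
  "nilpotent_pair scaleV scaleW f g \<longleftrightarrow>
     Vector_Spaces.linear scaleV scaleW f \<and> Vector_Spaces.linear scaleW scaleV g \<and>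
     nilpotent_map (g \<circ> f)"

text \<open>Rational-valued, so that the differences are not truncated and the quotient is exact.\<close>

definition q_binomial :: "nat \<Rightarrow> nat \<Rightarrow> nat \<Rightarrow> rat" where
  "q_binomial q m r =
     (\<Prod>i<r. of_nat q ^ m - of_nat q ^ i) / (\<Prod>i<r. of_nat q ^ r - of_nat q ^ i)"

end

theory Submission
  imports Defs "HOL-Library.Cardinality"
begin

text \<open>Fix \<open>f\<close> of rank \<open>r\<close>, with kernel \<open>K\<close>. The maps \<open>T = g \<circ> f\<close> are exactly the endomorphisms of \<open>V\<close>
  that vanish on \<open>K\<close>, and each \<open>T\<close> comes from \<open>q ^ (m * (n - r))\<close> maps \<open>g\<close>, since \<open>g\<close> is prescribed
  on the range of \<open>f\<close> and free on a complement of it. So the task is to count the nilpotent \<open>T\<close> that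
  vanish on \<open>K\<close>; there are \<open>q ^ (m * r - r)\<close>. Hence \<open>f\<close> has \<open>q ^ (m * n - r)\<close> partners \<open>g\<close>
  (\<open>card_nilpotent_partners\<close>), a number that depends on the rank of \<open>f\<close> only, and the formula follows
  from the number of maps of each rank (\<open>card_linear_of_rank\<close>).

  The count of nilpotent maps is a relative form of the Fine-Herstein theorem
  (\<open>card_nilpotent_extensions\<close>): if \<open>S\<close> preserves a subspace \<open>U\<close> of codimension \<open>d\<close>, then the number
  of \<open>T\<close> that agree with \<open>S\<close> on \<open>U\<close> and some power of which maps \<open>V\<close> into \<open>U\<close> is
  \<open>q ^ (m * d - d)\<close>, that is, a fraction \<open>1 / q ^ d\<close> of all extensions of \<open>S\<close> from \<open>U\<close>. With \<open>U = 0\<close>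
  these are the nilpotent endomorphisms; working modulo \<open>U\<close> replaces all passages to quotient spaces,
  and \<open>U = K\<close> is the case wanted above.

  To prove it, pick \<open>v\<close> outside \<open>U\<close> and prescribe \<open>T v\<close>, \<open>T (T v)\<close>, and so on, as long as these
  vectors are independent modulo \<open>U\<close>. The claim is strengthened to say that the fraction stays
  \<open>1 / q ^ d\<close> after any number of such prescriptions. Let \<open>w\<close> be the first value not yet prescribed,
  and \<open>X\<close> the span of \<open>U\<close> and the chain so far, of dimension \<open>u + k\<close>, where \<open>u\<close> is the dimension of
  \<open>U\<close>. If \<open>w\<close> is not in \<open>X\<close>, the chain gets longer and induction applies. If \<open>w\<close> is in \<open>X\<close>, then \<open>X\<close>
  is invariant, and nilpotency modulo \<open>U\<close> on a space of relative dimension \<open>k\<close> puts \<open>w\<close> in \<open>U\<close>.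
  Conversely, for \<open>w\<close> in \<open>U\<close> nilpotency modulo \<open>U\<close> is the same as nilpotency modulo \<open>X\<close>, so induction
  applies to \<open>X\<close>, with the larger fraction \<open>1 / q ^ (d - k)\<close>. There are \<open>q ^ u\<close> such \<open>w\<close>, and they
  contribute \<open>q ^ u * q ^ k\<close>, which is exactly what the \<open>q ^ (u + k)\<close> elements of \<open>X\<close> would contribute
  at the fraction \<open>1 / q ^ d\<close>.\<close>

section \<open>Vector spaces over a finite field\<close>

lemma card_eq_sum_fibres:
  assumes "finite A" "finite B" "f ` A \<subseteq> B"
  shows "card A = (\<Sum>b\<in>B. card {a \<in> A. f a = b})"
  using sum.group[OF assms, of "\<lambda>_. 1::nat"] by simp

locale finite_vector_space = finite_dimensional_vector_space scale Basis
  for scale :: "'k::{field, finite} \<Rightarrow> 'v::ab_group_add \<Rightarrow> 'v" (infixr \<open>*s\<close> 75)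
    and Basis :: "'v set"
begin

lemma q_pos: "CARD('k) > 0"
  by (simp add: card_gt_0_iff)

lemma bij_betw_span_insert:
  assumes "v \<notin> span A"
  shows "bij_betw (\<lambda>(c, a). c *s v + a) (UNIV \<times> span A) (span (insert v A))"
proof (rule bij_betw_imageI)
  show "inj_on (\<lambda>(c, a). c *s v + a) (UNIV \<times> span A)"
  proof (rule inj_onI, clarsimp)
    fix c a d b
    assume ab: "a \<in> span A" "b \<in> span A" and eq: "c *s v + a = d *s v + b"
    have "(c - d) *s v = b - a"
      using eq by (simp add: scale_left_diff_distrib algebra_simps)
    then have "(c - d) *s v \<in> span A" using ab span_diff by simp
    then have "c = d"
      using assms span_scale[of "(c - d) *s v" A "inverse (c - d)"] by (cases "c = d") auto
    then show "c = d \<and> a = b" using eq by simp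
  qed
  show "(\<lambda>(c, a). c *s v + a) ` (UNIV \<times> span A) = span (insert v A)"
  proof (safe; clarsimp?)
    fix c a assume "a \<in> span A"
    then show "c *s v + a \<in> span (insert v A)"
      by (simp add: span_breakdown_eq exI[of _ c])
  next
    fix x assume "x \<in> span (insert v A)"
    then obtain c where "x - c *s v \<in> span A" by (auto simp: span_breakdown_eq)
    then show "x \<in> (\<lambda>(c, a). c *s v + a) ` (UNIV \<times> span A)"
      by (intro image_eqI[of _ _ "(c, x - c *s v)"]) auto
  qed
qed

lemma finite_card_span_independent:
  assumes "finite B" "independent B"
  shows "finite (span B) \<and> card (span B) = CARD('k) ^ card B"
  using assms
proof (induction B rule: finite_induct)
  case (insert v B)
  then have "v \<notin> span B" "independent B" by (auto simp: independent_insert)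
  from bij_betw_span_insert[OF this(1)] insert this(2) show ?case
    using bij_betw_finite bij_betw_same_card by (fastforce simp: card_cartesian_product)
qed simp

lemma finite_universe: "finite (UNIV :: 'v set)"
  using finite_card_span_independent[OF finite_Basis independent_Basis] span_Basis by simp

lemma finite_space [simp]: "finite (A :: 'v set)"
  using finite_universe by (rule rev_finite_subset) simp

lemma card_span: "card (span A) = CARD('k) ^ dim A"
proof -
  obtain B where B: "B \<subseteq> A" "independent B" "A \<subseteq> span B" "card B = dim A"
    using basis_exists by blast
  then have "span B = span A" by (metis span_mono span_minimal subspace_span subset_antisym)
  then show ?thesis
    using finite_card_span_independent[of B] B finiteI_independent by auto
qed

lemma card_subspace: "subspace U \<Longrightarrow> card U = CARD('k) ^ dim U"
  using card_span[of U] by (simp add: span_eq_iff[THEN iffD2])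

lemma dim_le: "dim A \<le> dim (UNIV :: 'v set)"
  by (rule dim_subset) simp

lemma card_UNIV_diff_subspace:
  assumes "subspace U"
  shows "card (- U) = CARD('k) ^ dim (UNIV :: 'v set) - CARD('k) ^ dim U"
  using assms card_subspace[OF subspace_UNIV]
  by (simp add: card_subspace Compl_eq_Diff_UNIV card_Diff_subset)

text \<open>Independence modulo \<open>span A\<close>. Each vector is moved into the modulus in turn, so that the number of
  choices for the next vector depends only on the number of earlier ones.\<close>

primrec independent_mod :: "'v set \<Rightarrow> 'v list \<Rightarrow> bool" where
  "independent_mod A [] \<longleftrightarrow> True"
| "independent_mod A (v # vs) \<longleftrightarrow> v \<notin> span A \<and> independent_mod (insert v A) vs"

lemma independent_mod_mono:
  assumes "independent_mod A vs" "span B \<subseteq> span A"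
  shows "independent_mod B vs"
  using assms
proof (induction vs arbitrary: A B)
  case (Cons v vs)
  from Cons.prems(2) have "span (insert v B) \<subseteq> span (insert v A)"
    unfolding span_breakdown_eq subset_iff by blast
  with Cons show ?case by auto
qed simp

lemma dim_independent_mod:
  "independent_mod A vs \<Longrightarrow> dim (A \<union> set vs) = dim A + length vs"
proof (induction vs arbitrary: A)
  case (Cons v vs)
  then have "dim (insert v A \<union> set vs) = dim A + length (v # vs)"
    using Cons.IH[of "insert v A"] by (simp add: dim_insert del: Un_insert_left)
  moreover have "insert v A \<union> set vs = A \<union> set (v # vs)" by simp
  ultimately show ?case by (simp only:)
qed simp

lemma finite_lists_of_length: "finite {vs :: 'v list. length vs = k \<and> P vs}"
  by (rule finite_subset[OF _ finite_lists_length_eq[OF finite_universe, of k]]) auto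

lemma card_independent_mod:
  "card {vs. length vs = k \<and> independent_mod A vs} =
     (\<Prod>i<k. CARD('k) ^ dim (UNIV :: 'v set) - CARD('k) ^ (dim A + i))"
proof (induction k arbitrary: A)
  case 0
  have "{vs. length vs = 0 \<and> independent_mod A vs} = {[]}" by auto
  then show ?case by simp
next
  case (Suc k)
  let ?m = "dim (UNIV :: 'v set)"
  let ?L = "\<lambda>k A. {vs. length vs = k \<and> independent_mod A vs}"
  have "card (?L (Suc k) A) = (\<Sum>v\<in>- span A. card {vs \<in> ?L (Suc k) A. hd vs = v})"
    by (rule card_eq_sum_fibres) (rule finite_lists_of_length, auto simp: length_Suc_conv)
  also have "\<dots> = (\<Sum>v\<in>- span A. \<Prod>i<k. CARD('k) ^ ?m - CARD('k) ^ (Suc (dim A) + i))"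
  proof (rule sum.cong[OF refl])
    fix v assume v: "v \<in> - span A"
    then have "{vs \<in> ?L (Suc k) A. hd vs = v} = (#) v ` ?L k (insert v A)"
      by (auto simp: length_Suc_conv)
    then have "card {vs \<in> ?L (Suc k) A. hd vs = v} = card (?L k (insert v A))"
      by (simp add: card_image)
    then show "card {vs \<in> ?L (Suc k) A. hd vs = v} = (\<Prod>i<k. CARD('k) ^ ?m - CARD('k) ^ (Suc (dim A) + i))"
      using Suc[of "insert v A"] v by (simp add: dim_insert)
  qed
  also have "\<dots> = (\<Prod>i<Suc k. CARD('k) ^ ?m - CARD('k) ^ (dim A + i))"
    unfolding prod.lessThan_Suc_shift by (simp add: card_UNIV_diff_subspace)
  finally show ?case .
qed

end

locale finite_vector_space_pair =
  V: finite_vector_space s1 B1 + W: finite_vector_space s2 B2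
  for s1 :: "'k::{field, finite} \<Rightarrow> 'v::ab_group_add \<Rightarrow> 'v" and B1 :: "'v set"
    and s2 :: "'k \<Rightarrow> 'w::ab_group_add \<Rightarrow> 'w" and B2 :: "'w set"
begin

sublocale finite_dimensional_vector_space_pair s1 B1 s2 B2 ..

abbreviation lin :: "('v \<Rightarrow> 'w) \<Rightarrow> bool" where "lin \<equiv> Vector_Spaces.linear s1 s2"

lemma finite_maps [simp]: "finite (F :: ('v \<Rightarrow> 'w) set)"
proof (rule finite_subset)
  show "finite (UNIV \<rightarrow>\<^sub>E UNIV :: ('v \<Rightarrow> 'w) set)"
    by (intro finite_PiE) simp_all
qed (simp add: PiE_UNIV_domain)

lemma agree_on_span_insert:
  assumes "lin f" "lin g"
  shows "(\<forall>x\<in>V.span (insert v A). f x = g x) \<longleftrightarrow> (\<forall>x\<in>V.span A. f x = g x) \<and> f v = g v"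
proof safe
  fix x assume "\<forall>x\<in>V.span (insert v A). f x = g x" "x \<in> V.span A"
  then show "f x = g x" using V.span_mono[of A "insert v A"] by blast
next
  fix x assume "\<forall>x\<in>V.span A. f x = g x" "f v = g v" "x \<in> V.span (insert v A)"
  then show "f x = g x" using linear_eq_on[OF assms, of x "insert v A"] V.span_base by blast
next
  assume "\<forall>x\<in>V.span (insert v A). f x = g x"
  then show "f v = g v" using V.span_base[of v "insert v A"] by blast
qed

section \<open>Linear maps with prescribed values\<close>

text \<open>A prescribed map can be given any value at one further vector; the bound on the range is carried
  along because maps into the span of a given list are counted below.\<close>

lemma exists_linear_redefine:
  assumes S: "lin S" "range S \<subseteq> Y" and Y: "W.subspace Y" and w: "w \<in> Y" and v: "v \<notin> V.span A"
  obtains T where "lin T" "range T \<subseteq> Y" "\<And>x. x \<in> V.span A \<Longrightarrow> T x = S x" "T v = w"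
proof -
  obtain B where B: "B \<subseteq> A" "V.independent B" "A \<subseteq> V.span B"
    using V.maximal_independent_subset by blast
  have BA: "V.span B = V.span A"
    using B by (metis V.span_mono V.span_minimal V.subspace_span subset_antisym)
  with v B have ind: "V.independent (insert v B)" by (simp add: V.independent_insert)
  have vB: "v \<notin> B" using v BA V.span_base by blast
  from linear_independent_extend_subspace[OF ind, of "S(v := w)"]
  obtain T where T: "lin T" "\<forall>x\<in>insert v B. T x = (S(v := w)) x"
    "range T = W.span ((S(v := w)) ` insert v B)" by blast
  have "(S(v := w)) ` insert v B \<subseteq> Y" using S w by auto
  then have "range T \<subseteq> Y" unfolding T(3) by (rule W.span_minimal[OF _ Y])
  moreover have "T x = S x" if "x \<in> V.span A" for x
    using linear_eq_on[OF T(1) S(1), of x B] that BA T(2) vB by fastforce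
  ultimately show thesis using that[OF T(1)] T(2) by auto
qed

text \<open>Every vector outside \<open>span A\<close> that is adjoined to \<open>A\<close> can take each value in \<open>Y\<close>, independently of
  the others.\<close>

lemma card_linear_extensions:
  assumes "lin S" "range S \<subseteq> Y" "W.subspace Y"
  shows "card {f. lin f \<and> range f \<subseteq> Y \<and> (\<forall>x\<in>V.span A. f x = S x)} =
    card Y ^ (V.dim UNIV - V.dim A)"
  using assms(1,2)
proof (induction "V.dim UNIV - V.dim A" arbitrary: A S)
  case 0
  then have "V.dim A = V.dim UNIV" using V.dim_le[of A] by simp
  then have "V.span A = UNIV" using V.subspace_dim_equal[of "V.span A" UNIV] by simp
  then have "{f. lin f \<and> range f \<subseteq> Y \<and> (\<forall>x\<in>V.span A. f x = S x)} = {S}"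
    using 0 by auto
  then show ?case using 0(1) by simp
next
  case (Suc d)
  let ?F = "\<lambda>A S. {f. lin f \<and> range f \<subseteq> Y \<and> (\<forall>x\<in>V.span A. f x = S x)}"
  have "V.span A \<noteq> UNIV" using Suc(2) by (metis V.dim_span diff_self_eq_0 nat.distinct(1))
  then obtain v where v: "v \<notin> V.span A" by auto
  have "card (?F A S) = (\<Sum>y\<in>Y. card {f \<in> ?F A S. f v = y})"
    by (rule card_eq_sum_fibres) auto
  also have "\<dots> = (\<Sum>y\<in>Y. card Y ^ d)"
  proof (rule sum.cong[OF refl])
    fix y assume y: "y \<in> Y"
    obtain T where T: "lin T" "range T \<subseteq> Y" "\<And>x. x \<in> V.span A \<Longrightarrow> T x = S x" "T v = y"
      using exists_linear_redefine[OF Suc(3,4) assms(3) y v] by blast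
    have "(\<forall>x\<in>V.span (insert v A). f x = T x) \<longleftrightarrow> (\<forall>x\<in>V.span A. f x = S x) \<and> f v = y"
      if "lin f" for f
      unfolding agree_on_span_insert[OF that T(1)] using T(3,4) by simp
    then have "{f \<in> ?F A S. f v = y} = ?F (insert v A) T" by blast
    also have "card \<dots> = card Y ^ d"
    proof -
      have "d = V.dim UNIV - V.dim (insert v A)" using Suc(2) v by (simp add: V.dim_insert)
      then show ?thesis using Suc(1)[of "insert v A" T] T by simp
    qed
    finally show "card {f \<in> ?F A S. f v = y} = card Y ^ d" .
  qed
  also have "\<dots> = card Y ^ (V.dim UNIV - V.dim A)" using Suc(2)[symmetric] by simp
  finally show ?case .
qed

lemma exists_linear_on_independent_list:
  assumes "V.independent_mod A vs" "length ws = length vs" "set ws \<subseteq> Y"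
    and "lin S" "range S \<subseteq> Y" "W.subspace Y"
  shows "\<exists>T. lin T \<and> range T \<subseteq> Y \<and> (\<forall>x\<in>V.span A. T x = S x) \<and> map T vs = ws"
  using assms(1-5)
proof (induction vs arbitrary: A S ws)
  case Nil
  then show ?case by auto
next
  case (Cons v vs)
  then obtain w ws' where ws: "ws = w # ws'" by (cases ws) auto
  obtain T0 where T0: "lin T0" "range T0 \<subseteq> Y" "\<And>x. x \<in> V.span A \<Longrightarrow> T0 x = S x" "T0 v = w"
    using exists_linear_redefine[OF Cons.prems(4,5) assms(6), of w v A] Cons.prems ws by auto
  obtain T where T: "lin T" "range T \<subseteq> Y" "\<forall>x\<in>V.span (insert v A). T x = T0 x" "map T vs = ws'"
    using Cons.IH[of "insert v A" ws' T0] Cons.prems T0 ws by auto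
  then show ?case
    using T0 ws by (auto simp: agree_on_span_insert intro!: exI[of _ T])
qed

lemma card_linear_with_values:
  assumes "V.independent_mod {} vs" "length ws = length vs"
  shows "card {f. lin f \<and> range f \<subseteq> W.span (set ws) \<and> map f vs = ws} =
    card (W.span (set ws)) ^ (V.dim UNIV - length vs)"
proof -
  obtain S where S: "lin S" "range S \<subseteq> W.span (set ws)" "map S vs = ws"
    using exists_linear_on_independent_list[OF assms W.span_superset linear_zero]
      W.span_zero by auto
  have agree: "map f vs = ws \<longleftrightarrow> (\<forall>x\<in>V.span (set vs). f x = S x)" if "lin f" for f
  proof
    assume "map f vs = ws"
    then have "\<forall>x\<in>set vs. f x = S x" using S(3) by (metis map_eq_conv)
    then show "\<forall>x\<in>V.span (set vs). f x = S x" using linear_eq_on[OF that S(1)] by blast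
  next
    assume "\<forall>x\<in>V.span (set vs). f x = S x"
    then have "map f vs = map S vs" using V.span_base by auto
    then show "map f vs = ws" using S(3) by simp
  qed
  have "V.dim (set vs) = length vs" using V.dim_independent_mod[OF assms(1)] by simp
  then show ?thesis
    using card_linear_extensions[OF S(1,2) W.subspace_span, of "set vs"] agree
    by (simp cong: conj_cong)
qed

text \<open>The preimage of \<open>span B\<close> under \<open>f\<close> remains the span of the adjoined vectors when \<open>v\<close> joins \<open>A\<close> and
  \<open>f v\<close> joins \<open>B\<close>. With \<open>B\<close> empty, independence modulo the kernel is independence of the images.\<close>

lemma independent_mod_map_iff:
  assumes "lin f" "V.span A = f -` W.span B"
  shows "W.independent_mod B (map f vs) \<longleftrightarrow> V.independent_mod A vs"
  using assms(2)
proof (induction vs arbitrary: A B)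
  case (Cons v vs)
  interpret f: Vector_Spaces.linear s1 s2 f by fact
  have "V.span (insert v A) = f -` W.span (insert (f v) B)"
    using Cons.prems by (auto simp: V.span_breakdown_eq W.span_breakdown_eq f.diff f.scale)
  with Cons show ?case by auto
qed simp

end

section \<open>Nilpotent maps modulo an invariant subspace\<close>

text \<open>For a subspace \<open>U\<close> invariant under \<open>T\<close> this is nilpotency of the map that \<open>T\<close> induces on the
  quotient by \<open>U\<close>.\<close>

definition nilpotent_mod :: "'v set \<Rightarrow> ('v \<Rightarrow> 'v) \<Rightarrow> bool" where
  "nilpotent_mod U T \<longleftrightarrow> (\<exists>k. \<forall>x. (T ^^ k) x \<in> U)"

lemma funpow_invariant: "T ` U \<subseteq> U \<Longrightarrow> x \<in> U \<Longrightarrow> (T ^^ k) x \<in> U"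
  by (induction k) auto

context finite_vector_space
begin

interpretation endo: finite_vector_space_pair scale Basis scale Basis ..

lemma funpow_0_eq_id: "T ^^ 0 = id"
  by (rule ext) simp

lemma linear_funpow: "endo.lin T \<Longrightarrow> endo.lin (T ^^ k)"
proof (induction k)
  case (Suc k)
  then show ?case using Vector_Spaces.linear_compose[of scale scale "T ^^ k" scale T]
    by (simp only: funpow.simps)
qed (simp only: funpow_0_eq_id linear_id)

text \<open>The nilpotency index is at most the dimension, relative to \<open>U\<close>: the subspaces \<open>U + T X\<close>,
  \<open>U + T (T X)\<close>, and so on, shrink strictly until \<open>U\<close> is reached.\<close>

lemma nilpotent_mod_index_le:
  assumes U: "subspace U" and T: "endo.lin T" "T ` U \<subseteq> U" "nilpotent_mod U T"
    and X: "subspace X" "U \<subseteq> X" "T ` X \<subseteq> X" "dim X \<le> dim U + k" and x: "x \<in> X"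
  shows "(T ^^ k) x \<in> U"
  using X x
proof (induction k arbitrary: X x)
  case 0
  then have "U = X" using U by (intro subspace_dim_equal) auto
  then show ?case using 0 by simp
next
  case (Suc k)
  let ?Y = "span (U \<union> T ` X)"
  have YX: "?Y \<subseteq> X" using Suc.prems by (intro span_minimal) auto
  have TY: "T ` ?Y \<subseteq> ?Y"
    using YX span_superset[of "U \<union> T ` X"] by blast
  show ?case
  proof (cases "?Y = X")
    case True
    \<comment> \<open>If the descent from \<open>X\<close> stops at once it stops for ever, and nilpotency gives \<open>X = U\<close>.\<close>
    have "X \<subseteq> span (U \<union> (T ^^ j) ` X)" for j
    proof (induction j)
      case 0
      then show ?case using span_superset[of "U \<union> X"] by simp
    next
      case (Suc j)
      let ?Z = "span (U \<union> (T ^^ Suc j) ` X)"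
      have "U \<union> (T ^^ j) ` X \<subseteq> {x. T x \<in> ?Z}"
        using T(2) span_superset[of "U \<union> (T ^^ Suc j) ` X"] by (auto simp: image_subset_iff)
      then have "span (U \<union> (T ^^ j) ` X) \<subseteq> {x. T x \<in> ?Z}"
        by (rule span_minimal) (rule endo.linear_subspace_linear_preimage[OF T(1) subspace_span])
      then have "U \<union> T ` X \<subseteq> ?Z" using Suc span_superset[of "U \<union> (T ^^ Suc j) ` X"] by auto
      then have "?Y \<subseteq> ?Z" by (rule span_minimal[OF _ subspace_span])
      then show ?case using True by simp
    qed
    moreover obtain j where "\<forall>x. (T ^^ j) x \<in> U" using T(3) by (auto simp: nilpotent_mod_def)
    moreover from this have "span (U \<union> (T ^^ j) ` X) \<subseteq> U"
      using U by (intro span_minimal) auto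
    ultimately have "X \<subseteq> U" by blast
    then show ?thesis using funpow_invariant[OF T(2)] Suc.prems by blast
  next
    case False
    then have "dim ?Y < dim X"
      using YX Suc.prems(1) dim_psubset[of ?Y X] by (simp add: span_eq_iff[THEN iffD2] psubset_eq)
    then have "(T ^^ k) (T x) \<in> U"
      using Suc.prems span_superset[of "U \<union> T ` X"] TY by (intro Suc.IH[of ?Y]) auto
    then show ?thesis by (simp add: funpow_swap1)
  qed
qed

definition chain :: "'v set \<Rightarrow> ('v \<Rightarrow> 'v) \<Rightarrow> 'v \<Rightarrow> nat \<Rightarrow> 'v set" where
  "chain U T v n = U \<union> (\<lambda>i. (T ^^ i) v) ` {..<n}"

lemma chain_0: "chain U T v 0 = U"
  by (simp add: chain_def)

lemma chain_Suc: "chain U T v (Suc n) = insert ((T ^^ n) v) (chain U T v n)"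
  by (auto simp: chain_def lessThan_Suc)

lemma span_chain_invariant:
  assumes "endo.lin T" "T ` U \<subseteq> U" "(T ^^ n) v \<in> span (chain U T v n)"
  shows "T ` span (chain U T v n) \<subseteq> span (chain U T v n)"
proof -
  let ?X = "span (chain U T v n)"
  have "T ((T ^^ i) v) \<in> ?X" if "i < n" for i
  proof (cases "Suc i = n")
    case False
    then have "(T ^^ Suc i) v \<in> chain U T v n" using that unfolding chain_def by (intro UnI2 imageI) simp
    then show ?thesis using span_base by simp
  qed (use assms(3) in auto)
  moreover have "T x \<in> ?X" if "x \<in> U" for x
    using that assms(2) by (intro span_base) (auto simp: chain_def)
  ultimately have "chain U T v n \<subseteq> {x. T x \<in> ?X}" by (auto simp: chain_def)
  then have "?X \<subseteq> {x. T x \<in> ?X}"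
    by (rule span_minimal) (rule endo.linear_subspace_linear_preimage[OF assms(1) subspace_span])
  then show ?thesis by auto
qed

lemma funpow_chain_in:
  assumes "subspace U" "endo.lin T" "T ` U \<subseteq> U" "(T ^^ n) v \<in> U" "x \<in> span (chain U T v n)"
  shows "(T ^^ n) x \<in> U"
proof -
  have "(T ^^ n) ((T ^^ i) v) \<in> U" for i
  proof -
    have "(T ^^ n) ((T ^^ i) v) = (T ^^ i) ((T ^^ n) v)"
      by (simp add: funpow_add[symmetric, unfolded o_def, THEN fun_cong] add.commute)
    then show ?thesis using funpow_invariant[OF assms(3,4)] by simp
  qed
  then have "chain U T v n \<subseteq> {x. (T ^^ n) x \<in> U}"
    using funpow_invariant[OF assms(3)] by (auto simp: chain_def)
  then have "span (chain U T v n) \<subseteq> {x. (T ^^ n) x \<in> U}"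
    by (rule span_minimal)
      (rule endo.linear_subspace_linear_preimage[OF linear_funpow[OF assms(2)] assms(1)])
  then show ?thesis using assms(5) by auto
qed

lemma funpow_agree_on_chain:
  assumes "\<forall>x\<in>span (chain U S v n). T x = S x" "i \<le> n"
  shows "(T ^^ i) v = (S ^^ i) v"
  using assms(2)
proof (induction i)
  case (Suc i)
  then have "(S ^^ i) v \<in> span (chain U S v n)" by (intro span_base) (auto simp: chain_def)
  then show ?case using Suc assms(1) by simp
qed simp

lemma chain_cong:
  assumes "\<forall>x\<in>span (chain U S v n). T x = S x" "k \<le> Suc n"
  shows "chain U T v k = chain U S v k"
  using funpow_agree_on_chain[OF assms(1)] assms(2) by (auto simp: chain_def)

definition nilpotent_extensions :: "'v set \<Rightarrow> 'v set \<Rightarrow> ('v \<Rightarrow> 'v) \<Rightarrow> ('v \<Rightarrow> 'v) set" where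
  "nilpotent_extensions U A S =
     {T. endo.lin T \<and> (\<forall>x\<in>span A. T x = S x) \<and> nilpotent_mod U T}"

lemma nilpotent_extensions_UNIV: "endo.lin S \<Longrightarrow> nilpotent_extensions UNIV UNIV S = {S}"
  by (auto simp: nilpotent_extensions_def nilpotent_mod_def)

section \<open>Counting nilpotent extensions\<close>

text \<open>Once the chain of \<open>v\<close> ends in \<open>U\<close>, the map is already nilpotent modulo \<open>U\<close> on the span \<open>X\<close> of the
  chain, and the only remaining condition is that some power maps the whole space into \<open>X\<close>.\<close>

lemma nilpotent_extensions_chain_closed:
  assumes U: "subspace U" and S: "endo.lin S" "S ` U \<subseteq> U" "(S ^^ n) v \<in> U"
  defines "X \<equiv> span (chain U S v n)"
  shows "nilpotent_extensions U (chain U S v n) S = nilpotent_extensions X X S"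
proof -
  have UX: "U \<subseteq> X" unfolding X_def using span_superset[of "chain U S v n"] by (auto simp: chain_def)
  have "nilpotent_mod U T" if T: "endo.lin T" "\<forall>x\<in>X. T x = S x" "nilpotent_mod X T" for T
  proof -
    obtain k where k: "\<And>x. (T ^^ k) x \<in> X" using T(3) by (auto simp: nilpotent_mod_def)
    have TU: "T ` U \<subseteq> U" using T(2) UX S(2) by fastforce
    have "(T ^^ n) v \<in> U" using funpow_agree_on_chain[of U S v n T n] T(2) S(3) X_def by auto
    moreover have "X = span (chain U T v n)"
      unfolding X_def using chain_cong[of U S v n T n] T(2) X_def by simp
    ultimately have "(T ^^ n) ((T ^^ k) x) \<in> U" for x
      using funpow_chain_in[OF U T(1) TU, of n v "(T ^^ k) x"] k by blast
    then have "\<forall>x. (T ^^ (n + k)) x \<in> U" by (simp add: funpow_add)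
    then show ?thesis unfolding nilpotent_mod_def by blast
  qed
  moreover have "nilpotent_mod X T" if "nilpotent_mod U T" for T
    using that UX by (auto simp: nilpotent_mod_def)
  ultimately show ?thesis
    unfolding nilpotent_extensions_def X_def by (auto simp: span_span)
qed

text \<open>Among all extensions of \<open>S\<close> from the span of \<open>chain U S v j\<close>, of which there are as many as the
  right-hand side says, a fraction \<open>1 / q ^ d\<close> is nilpotent modulo \<open>U\<close>, where \<open>d\<close> is the codimension
  of \<open>U\<close>. The fraction does not depend on \<open>j\<close>. The map \<open>S\<close> carries two kinds of data: its values on
  \<open>U\<close> and the first \<open>j\<close> steps of the chain of \<open>v\<close>; the value at the last vector of the chain is the
  one summed over.\<close>

lemma card_nilpotent_extensions_chain:
  assumes "subspace U" "endo.lin S" "S ` U \<subseteq> U"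
    and "dim (chain U S v (Suc j)) = dim U + Suc j"
  shows "card (nilpotent_extensions U (chain U S v j) S) * CARD('k) ^ (dim (UNIV :: 'v set) - dim U)
    = CARD('k) ^ (dim (UNIV :: 'v set) * (dim (UNIV :: 'v set) - (dim U + j)))"
  using assms
proof (induction "dim (UNIV :: 'v set) - (dim U + Suc j)" arbitrary: U S v j rule: less_induct)
  case less
  let ?m = "dim (UNIV :: 'v set)" and ?q = "CARD('k)"
  define D where "D = chain U S v j"
  define X where "X = span (chain U S v (Suc j))"
  define x0 where "x0 = (S ^^ j) v"
  define e where "e = ?m - (dim U + Suc j)"
  note U = less.prems(1) and S = less.prems(2,3)
  have XD: "X = span (insert x0 D)" unfolding X_def D_def x0_def chain_Suc ..
  have dimX: "dim X = dim U + Suc j" using less.prems(4) X_def by simp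
  have m: "?m = dim U + Suc j + e" using dim_le[of X] dimX e_def by simp
  have UD: "U \<subseteq> D" by (auto simp: D_def chain_def)
  then have UX: "U \<subseteq> X" using XD span_superset[of "insert x0 D"] by auto
  have x0: "x0 \<notin> span D"
  proof
    assume "x0 \<in> span D"
    then have "dim U + Suc j = dim D" using dimX XD by (simp add: span_redundant)
    moreover have "dim D \<le> dim U + j"
    proof -
      have "dim (chain U S v i) \<le> dim U + i" for i
        by (induction i) (auto simp: chain_0 chain_Suc dim_insert)
      then show ?thesis by (simp add: D_def)
    qed
    ultimately show False by simp
  qed
  let ?N = "\<lambda>w. {T \<in> nilpotent_extensions U D S. T x0 = w}"
  have "\<exists>R. endo.lin R \<and> (\<forall>x\<in>span D. R x = S x) \<and> R x0 = w" for w
    using endo.exists_linear_redefine[OF S(1) subset_UNIV subspace_UNIV UNIV_I x0, of w] by metis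
  then obtain R where R: "\<And>w. endo.lin (R w)" "\<And>w. \<forall>x\<in>span D. R w x = S x" "\<And>w. R w x0 = w"
    by metis
  have chainR: "chain U (R w) v k = chain U S v k" if "k \<le> Suc j" for w k
    using chain_cong[OF _ that] R(2) by (simp add: D_def)
  have powR: "(R w ^^ Suc j) v = w" for w
    using funpow_agree_on_chain[of U S v j "R w" j] R(2,3)[of w] by (simp add: D_def x0_def)
  have RU: "R w ` U \<subseteq> U" for w
    using R(2) UD S(2) span_superset[of D] by fastforce
  have N: "?N w = nilpotent_extensions U (chain U (R w) v (Suc j)) (R w)" for w
  proof -
    have "chain U (R w) v (Suc j) = insert x0 D" by (simp only: chainR) (simp add: chain_Suc D_def x0_def)
    moreover have "(\<forall>x\<in>span (insert x0 D). T x = R w x) \<longleftrightarrow> (\<forall>x\<in>span D. T x = S x) \<and> T x0 = w"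
      if "endo.lin T" for T
      unfolding endo.agree_on_span_insert[OF that R(1)] using R(2,3)[of w] by simp
    ultimately show ?thesis unfolding nilpotent_extensions_def by auto
  qed
  \<comment> \<open>The chain grows by \<open>w\<close>: each such \<open>w\<close> contributes the fraction \<open>1 / q ^ d\<close>.\<close>
  have outside: "card (?N w) * ?q ^ (?m - dim U) = ?q ^ (?m * e)" if "w \<notin> X" for w
  proof -
    have "dim (chain U (R w) v (Suc (Suc j))) = dim U + Suc (Suc j)"
      using that dimX unfolding chain_Suc[of _ _ _ "Suc j"] powR chainR[OF order_refl]
      by (simp add: dim_insert X_def)
    moreover have "?m - (dim U + Suc (Suc j)) < ?m - (dim U + Suc j)"
    proof -
      have "X \<noteq> UNIV" using that by auto
      then have "dim X \<noteq> ?m" using subspace_dim_equal[of X UNIV] X_def by auto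
      then show ?thesis using dim_le[of X] dimX by simp
    qed
    ultimately show ?thesis
      using less.hyps[of U "Suc j" "R w" v] U R(1) RU unfolding N e_def by blast
  qed
  \<comment> \<open>The chain closes up, and the modulus grows from \<open>U\<close> to \<open>X\<close>: the codimension drops by
    \<open>Suc j\<close>, and so each such \<open>w\<close> contributes \<open>q ^ Suc j\<close> times as much as one outside \<open>X\<close>.\<close>
  have inside: "card (?N w) * ?q ^ (?m - dim U) = ?q ^ (?m * e) * ?q ^ Suc j" if "w \<in> U" for w
  proof -
    have NX: "?N w = nilpotent_extensions X X (R w)"
      unfolding N using nilpotent_extensions_chain_closed[OF U R(1)[of w] RU[of w], of "Suc j" v] powR that
      by (simp add: chainR X_def)
    have "card (nilpotent_extensions X X (R w)) * ?q ^ e = ?q ^ (?m * e)"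
    proof (cases "X = UNIV")
      case True
      then show ?thesis using nilpotent_extensions_UNIV[OF R(1)] dimX m by simp
    next
      case False
      then obtain v' where v': "v' \<notin> X" by auto
      have "X = span (chain U (R w) v (Suc j))" using chainR X_def by simp
      then have RX: "R w ` X \<subseteq> X"
        using span_chain_invariant[OF R(1)[of w] RU[of w], of "Suc j" v] powR[of w] that UX by auto
      have sX: "subspace X" using X_def by simp
      have dX: "dim (chain X (R w) v' (Suc 0)) = dim X + Suc 0"
        using v' sX by (simp add: chain_Suc chain_0 dim_insert span_eq_iff[THEN iffD2])
      have "dim X \<noteq> ?m" using False subspace_dim_equal[of X UNIV] X_def by auto
      then have "?m - (dim X + Suc 0) < ?m - (dim U + Suc j)"
        using dim_le[of X] dimX by simp
      from less.hyps[OF this sX R(1) RX dX] show ?thesis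
        by (simp add: chain_0 dimX e_def)
    qed
    moreover have "?m - dim U = e + Suc j" using m by simp
    ultimately show ?thesis unfolding NX by (simp only: power_add mult.assoc[symmetric])
  qed
  \<comment> \<open>Here \<open>X\<close> is invariant, and the bound on the nilpotency index forces \<open>w\<close> into \<open>U\<close>.\<close>
  have between: "?N w = {}" if "w \<in> X" "w \<notin> U" for w
  proof -
    have False if T: "T \<in> ?N w" for T
    proof -
      have lT: "endo.lin T" and nT: "nilpotent_mod U T" and aT: "\<forall>x\<in>span D. T x = S x"
        and Tx0: "T x0 = w" using T by (auto simp: nilpotent_extensions_def)
      have ch: "chain U T v (Suc j) = chain U S v (Suc j)"
        using chain_cong[of U S v j T "Suc j"] aT by (simp add: D_def)
      have pT: "(T ^^ Suc j) v = w"
        using funpow_agree_on_chain[of U S v j T j] aT Tx0 by (simp add: D_def x0_def)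
      have TU: "T ` U \<subseteq> U" using aT UD S(2) span_superset[of D] by fastforce
      have TX: "T ` X \<subseteq> X"
        using span_chain_invariant[OF lT TU, of "Suc j" v] pT \<open>w \<in> X\<close> ch X_def by simp
      have "v \<in> X" 
      proof -
        have "(S ^^ 0) v \<in> chain U S v (Suc j)" unfolding chain_def by (intro UnI2 imageI) simp
        then show ?thesis unfolding X_def by (intro span_base) simp
      qed
      then have "(T ^^ Suc j) v \<in> U"
        using nilpotent_mod_index_le[OF U lT TU nT _ UX TX, of "Suc j" v] dimX X_def by simp
      then show False using pT \<open>w \<notin> U\<close> by simp
    qed
    then show ?thesis by blast
  qed
  have "card (nilpotent_extensions U D S) = (\<Sum>w\<in>UNIV. card (?N w))"
    by (rule card_eq_sum_fibres) auto
  also have "\<dots> = (\<Sum>w\<in>- X. card (?N w)) + (\<Sum>w\<in>X. card (?N w))"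
    using sum.union_disjoint[of "- X" X "\<lambda>w. card (?N w)"] by (simp add: Un_commute)
  also have "(\<Sum>w\<in>X. card (?N w)) = (\<Sum>w\<in>U. card (?N w))"
    using UX between by (intro sum.mono_neutral_right) (auto simp: card_eq_0_iff)
  finally have "card (nilpotent_extensions U D S) * ?q ^ (?m - dim U) =
      (\<Sum>w\<in>- X. card (?N w) * ?q ^ (?m - dim U)) + (\<Sum>w\<in>U. card (?N w) * ?q ^ (?m - dim U))"
    by (simp add: sum_distrib_right distrib_right)
  also have "\<dots> = card (- X) * ?q ^ (?m * e) + card U * (?q ^ (?m * e) * ?q ^ Suc j)"
    using outside inside by simp
  \<comment> \<open>The surplus inside \<open>U\<close> makes up for the rest of \<open>X\<close>, as \<open>card X = card U * q ^ Suc j\<close>.\<close>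
  also have "\<dots> = (card (- X) + card X) * ?q ^ (?m * e)"
  proof -
    have "card X = card U * ?q ^ Suc j"
      unfolding X_def card_span using card_subspace[OF U] less.prems(4) by (simp only: power_add)
    then show ?thesis by (simp only: distrib_right distrib_left mult_ac)
  qed
  also have "card (- X) + card X = ?q ^ ?m"
    using card_subspace[OF subspace_UNIV] card_Un_disjoint[of "- X" X]
    by (simp only: finite_space Compl_partition2 Compl_disjoint2 simp_thms)
  also have "?q ^ ?m * ?q ^ (?m * e) = ?q ^ (?m * (?m - (dim U + j)))"
  proof -
    have "?m - (dim U + j) = Suc e" using m by simp
    then show ?thesis by (simp only: mult_Suc_right power_add)
  qed
  finally show ?case by (simp add: D_def)
qed

text \<open>The case of a chain of length 0, which says nothing about \<open>v\<close>. For \<open>U = {0}\<close> this is the theorem of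
  Fine and Herstein that \<open>q ^ (m\<^sup>2 - m)\<close> endomorphisms are nilpotent.\<close>

lemma card_nilpotent_extensions:
  assumes "subspace U" "endo.lin S" "S ` U \<subseteq> U"
  shows "card (nilpotent_extensions U U S) * CARD('k) ^ (dim (UNIV :: 'v set) - dim U)
    = CARD('k) ^ (dim (UNIV :: 'v set) * (dim (UNIV :: 'v set) - dim U))"
proof (cases "U = UNIV")
  case True
  then show ?thesis using nilpotent_extensions_UNIV[OF assms(2)] by simp
next
  case False
  then obtain v where "v \<notin> U" by auto
  then show ?thesis
    using card_nilpotent_extensions_chain[OF assms, of v 0] assms(1)
    by (simp add: chain_Suc chain_0 dim_insert span_eq_iff[THEN iffD2])
qed

end

section \<open>Linear maps by rank, and nilpotent pairs\<close>

context finite_vector_space_pair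
begin

abbreviation rank :: "('v \<Rightarrow> 'w) \<Rightarrow> nat" where "rank f \<equiv> W.dim (range f)"

lemma one_less_q: "1 < CARD('k)"
proof -
  have "card {0, 1 :: 'k} \<le> CARD('k)" by (intro card_mono) auto
  then show ?thesis by simp
qed

lemma rank_plus_nullity:
  assumes "lin f"
  shows "rank f + V.dim {x. f x = 0} = V.dim UNIV"
proof -
  interpret f: Vector_Spaces.linear s1 s2 f by fact
  let ?K = "{x. f x = 0}"
  have "card (UNIV :: 'v set) = (\<Sum>y\<in>range f. card {x \<in> UNIV. f x = y})"
    by (rule card_eq_sum_fibres) auto
  also have "\<dots> = (\<Sum>y\<in>range f. card ?K)"
  proof (rule sum.cong[OF refl])
    fix y assume "y \<in> range f"
    then obtain a where a: "y = f a" by auto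
    have "{x \<in> UNIV. f x = y} = (+) a ` ?K"
    proof (intro equalityI subsetI)
      fix x assume "x \<in> {x \<in> UNIV. f x = y}"
      then show "x \<in> (+) a ` ?K" using a by (intro image_eqI[of _ _ "x - a"]) (auto simp: f.diff)
    qed (auto simp: a f.add)
    then show "card {x \<in> UNIV. f x = y} = card ?K" by (simp add: card_image)
  qed
  also have "\<dots> = CARD('k) ^ rank f * CARD('k) ^ V.dim ?K"
    using W.card_subspace[OF f.subspace_image[OF V.subspace_UNIV]]
      V.card_subspace[OF f.subspace_kernel] by simp
  finally show ?thesis
    using V.card_subspace[OF V.subspace_UNIV] one_less_q by (simp add: power_add[symmetric])
qed

text \<open>Double counting of the pairs of a map \<open>f\<close> of rank \<open>r\<close> and a list \<open>vs\<close> of \<open>r\<close> vectors independent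
  modulo the kernel of \<open>f\<close>. For given \<open>f\<close> the lists are counted in \<open>V\<close> modulo the kernel. On the other
  hand, \<open>vs\<close> and its image \<open>ws\<close> are independent lists, and any two such lists are joined by the maps
  that send \<open>vs\<close> to \<open>ws\<close> and have range in the span of \<open>ws\<close>. Both counts contain the same power of \<open>q\<close>,
  which cancels.\<close>

lemma card_linear_of_rank:
  assumes "r \<le> V.dim UNIV"
  shows "card {f. lin f \<and> rank f = r} * (\<Prod>i<r. CARD('k) ^ r - CARD('k) ^ i) =
    (\<Prod>i<r. CARD('k) ^ V.dim UNIV - CARD('k) ^ i) * (\<Prod>i<r. CARD('k) ^ W.dim UNIV - CARD('k) ^ i)"
proof -
  let ?q = "CARD('k)" and ?m = "V.dim UNIV" and ?n = "W.dim UNIV"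
  let ?F = "{f. lin f \<and> rank f = r}"
  let ?L = "\<lambda>f. {vs. length vs = r \<and> V.independent_mod {x. f x = 0} vs}"
  let ?IV = "{vs. length vs = r \<and> V.independent_mod {} vs}"
  let ?IW = "{ws. length ws = r \<and> W.independent_mod {} ws}"
  define P where "P = Sigma ?F ?L"
  have rank_iff: "rank f = r \<and> V.independent_mod {x. f x = 0} vs \<longleftrightarrow>
      V.independent_mod {} vs \<and> W.independent_mod {} (map f vs) \<and> range f \<subseteq> W.span (set (map f vs))"
    if f: "lin f" and vs: "length vs = r" for f vs
  proof -
    interpret f: Vector_Spaces.linear s1 s2 f by fact
    have "V.span {x. f x = 0} = f -` W.span {}"
      using f.subspace_kernel by (auto simp: V.span_eq_iff[THEN iffD2])
    note iff = independent_mod_map_iff[OF f this, of vs]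
    have "V.independent_mod {} vs" if "V.independent_mod {x. f x = 0} vs"
      using V.independent_mod_mono[OF that, of "{}"] V.span_zero[of "{x. f x = 0}"] by simp
    moreover have "rank f = r \<longleftrightarrow> range f \<subseteq> W.span (set (map f vs))"
      if "W.independent_mod {} (map f vs)"
    proof -
      have dim: "W.dim (set (map f vs)) = r"
        using W.dim_independent_mod[OF that] vs by simp
      have sub: "W.span (set (map f vs)) \<subseteq> range f"
        by (intro W.span_minimal f.subspace_image V.subspace_UNIV) auto
      show ?thesis
      proof
        assume "rank f = r"
        then have "W.span (set (map f vs)) = range f"
          using dim by (intro W.subspace_dim_equal sub W.subspace_span f.subspace_image V.subspace_UNIV) simp
        then show "range f \<subseteq> W.span (set (map f vs))" by simp
      next
        assume "range f \<subseteq> W.span (set (map f vs))"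
        then have "range f = W.span (set (map f vs))" using sub by blast
        then show "rank f = r" using dim by (simp only: W.dim_span)
      qed
    qed
    ultimately show ?thesis using iff by blast
  qed
  have "card P = (\<Sum>f\<in>?F. card (?L f))"
    unfolding P_def using V.finite_lists_of_length by (intro card_SigmaI) auto
  also have "\<dots> = (\<Sum>f\<in>?F. \<Prod>i<r. ?q ^ (?m - r) * (?q ^ r - ?q ^ i))"
  proof (rule sum.cong[OF refl])
    fix f assume "f \<in> ?F"
    then have "V.dim {x. f x = 0} = ?m - r" using rank_plus_nullity[of f] by simp
    then show "card (?L f) = (\<Prod>i<r. ?q ^ (?m - r) * (?q ^ r - ?q ^ i))"
      using assms by (simp add: V.card_independent_mod diff_mult_distrib2 power_add[symmetric] del: V.dim_UNIV)
  qed
  also have "\<dots> = card ?F * (\<Prod>i<r. ?q ^ r - ?q ^ i) * (?q ^ (?m - r)) ^ r"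
    by (simp add: prod.distrib)
  finally have P1: "card P = card ?F * (\<Prod>i<r. ?q ^ r - ?q ^ i) * (?q ^ (?m - r)) ^ r" .
  have "card P = (\<Sum>(vs, ws)\<in>?IV \<times> ?IW. card {p \<in> P. (snd p, map (fst p) (snd p)) = (vs, ws)})"
    unfolding case_prod_beta prod.collapse
  proof (rule card_eq_sum_fibres)
    show "finite P" unfolding P_def using V.finite_lists_of_length by (intro finite_SigmaI) auto
    show "finite (?IV \<times> ?IW)"
      using V.finite_lists_of_length W.finite_lists_of_length by (intro finite_cartesian_product)
    show "(\<lambda>p. (snd p, map (fst p) (snd p))) ` P \<subseteq> ?IV \<times> ?IW"
    proof (intro image_subsetI)
      fix p assume p: "p \<in> P"
      obtain f vs where fvs: "p = (f, vs)" by (cases p)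
      have f: "lin f" "rank f = r" "length vs = r" "V.independent_mod {x. f x = 0} vs"
        using p by (simp_all add: P_def fvs)
      then show "(snd p, map (fst p) (snd p)) \<in> ?IV \<times> ?IW"
        using rank_iff[OF f(1,3)] by (simp add: fvs)
    qed
  qed
  also have "\<dots> = (\<Sum>(vs, ws)\<in>?IV \<times> ?IW. (?q ^ r) ^ (?m - r))"
  proof (rule sum.cong[OF refl])
    fix z assume "z \<in> ?IV \<times> ?IW"
    then obtain vs ws where z: "z = (vs, ws)" and vs: "V.independent_mod {} vs" "length vs = r"
      and ws: "W.independent_mod {} ws" "length ws = length vs" by auto
    have "{p \<in> P. (snd p, map (fst p) (snd p)) = (vs, ws)} =
        (\<lambda>f. (f, vs)) ` {f. lin f \<and> range f \<subseteq> W.span (set ws) \<and> map f vs = ws}"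
    proof -
      have "f \<in> ?F \<and> vs \<in> ?L f \<and> map f vs = ws \<longleftrightarrow>
          lin f \<and> range f \<subseteq> W.span (set ws) \<and> map f vs = ws" for f
        using rank_iff[of f vs] vs ws(1) by blast
      then have "{f. f \<in> ?F \<and> vs \<in> ?L f \<and> map f vs = ws} =
          {f. lin f \<and> range f \<subseteq> W.span (set ws) \<and> map f vs = ws}" by blast
      moreover have "{p \<in> P. (snd p, map (fst p) (snd p)) = (vs, ws)} =
          (\<lambda>f. (f, vs)) ` {f. f \<in> ?F \<and> vs \<in> ?L f \<and> map f vs = ws}"
        unfolding P_def by auto
      ultimately show ?thesis by simp
    qed
    then have "card {p \<in> P. (snd p, map (fst p) (snd p)) = (vs, ws)} =
        card (W.span (set ws)) ^ (?m - length vs)"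
      using card_linear_with_values[OF vs(1) ws(2)] by (simp add: card_image inj_on_def)
    then show "(case z of (vs, ws) \<Rightarrow> card {p \<in> P. (snd p, map (fst p) (snd p)) = (vs, ws)}) =
        (case z of (vs, ws) \<Rightarrow> (?q ^ r) ^ (?m - r))"
      using W.dim_independent_mod[OF ws(1)] ws(2) vs(2) by (simp add: W.card_span z)
  qed
  also have "\<dots> = card ?IV * card ?IW * (?q ^ (?m - r)) ^ r"
    by (simp add: card_cartesian_product power_mult[symmetric] mult.commute)
  finally have "card ?F * (\<Prod>i<r. ?q ^ r - ?q ^ i) = card ?IV * card ?IW"
    unfolding P1 using V.q_pos by simp
  then show ?thesis by (simp add: V.card_independent_mod W.card_independent_mod)
qed

text \<open>Composition with \<open>f\<close> sends the partners \<open>g\<close> onto the nilpotent endomorphisms \<open>T\<close> vanishing on the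
  kernel \<open>K\<close> of \<open>f\<close>. For such \<open>T\<close>, nilpotency and nilpotency modulo \<open>K\<close> coincide, because one more
  application of \<open>T\<close> kills \<open>K\<close>.\<close>

lemma card_nilpotent_partners:
  assumes f: "lin f"
  shows "card {g. Vector_Spaces.linear s2 s1 g \<and> nilpotent_map (g \<circ> f)} * CARD('k) ^ rank f
    = CARD('k) ^ (V.dim UNIV * W.dim UNIV)"
proof -
  interpret f: Vector_Spaces.linear s1 s2 f by fact
  interpret opp: finite_vector_space_pair s2 B2 s1 B1 ..
  interpret endo: finite_vector_space_pair s1 B1 s1 B1 ..
  let ?q = "CARD('k)" and ?m = "V.dim UNIV" and ?n = "W.dim UNIV" and ?r = "rank f"
  let ?G = "{g. Vector_Spaces.linear s2 s1 g \<and> nilpotent_map (g \<circ> f)}"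
  define K where "K = {x. f x = 0}"
  define E where "E = V.nilpotent_extensions K K (\<lambda>_. 0)"
  have K: "V.subspace K" unfolding K_def by (rule f.subspace_kernel)
  have E: "T \<in> E \<longleftrightarrow> Vector_Spaces.linear s1 s1 T \<and> (\<forall>x\<in>K. T x = 0) \<and> nilpotent_map T" for T
  proof -
    have "nilpotent_map T" if "\<forall>x\<in>K. T x = 0" "\<forall>x. (T ^^ k) x \<in> K" for k
    proof -
      have "T ^^ Suc k = (\<lambda>_. 0)" using that by auto
      then show ?thesis unfolding nilpotent_map_def by blast
    qed
    moreover have "nilpotent_mod K T" if "nilpotent_map T"
      using that V.subspace_0[OF K] unfolding nilpotent_map_def nilpotent_mod_def by metis
    ultimately show ?thesis
      unfolding E_def V.nilpotent_extensions_def nilpotent_mod_def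
      using K by (auto simp: V.span_eq_iff[THEN iffD2])
  qed
  have rm: "?r + V.dim K = ?m" using rank_plus_nullity[OF f] K_def by simp
  have rn: "?r \<le> ?n" by (rule W.dim_le)
  have "card E * ?q ^ (?m - V.dim K) = ?q ^ (?m * (?m - V.dim K))"
    unfolding E_def by (rule V.card_nilpotent_extensions[OF K endo.linear_zero]) (use V.subspace_0[OF K] in auto)
  then have cE: "card E * ?q ^ ?r = ?q ^ (?m * ?r)" using rm by (metis add_diff_cancel_right')
  have "card ?G = (\<Sum>T\<in>E. card {g \<in> ?G. g \<circ> f = T})"
  proof (rule card_eq_sum_fibres)
    show "(\<lambda>g. g \<circ> f) ` ?G \<subseteq> E"
    proof (clarify, subst E, intro conjI ballI)
      fix g assume g: "Vector_Spaces.linear s2 s1 g" "nilpotent_map (g \<circ> f)"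
      interpret g: Vector_Spaces.linear s2 s1 g by fact
      show "Vector_Spaces.linear s1 s1 (g \<circ> f)" by (rule Vector_Spaces.linear_compose[OF f g(1)])
      show "nilpotent_map (g \<circ> f)" by fact
      show "(g \<circ> f) x = 0" if "x \<in> K" for x using that by (simp add: K_def)
    qed
  qed auto
  also have "\<dots> = (\<Sum>T\<in>E. ?q ^ (?m * (?n - ?r)))"
  proof (rule sum.cong[OF refl])
    fix T assume "T \<in> E"
    then have T: "Vector_Spaces.linear s1 s1 T" "\<And>x. f x = 0 \<Longrightarrow> T x = 0" "nilpotent_map T"
      by (auto simp: E K_def)
    interpret T: Vector_Spaces.linear s1 s1 T by fact
    \<comment> \<open>For a section \<open>h\<close> of \<open>f\<close> over its range, \<open>T \<circ> h\<close> is one solution \<open>g\<close> of \<open>g \<circ> f = T\<close>.\<close>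
    obtain h where h: "Vector_Spaces.linear s2 s1 h" "\<forall>y\<in>range f. f (h y) = y"
      using linear_exists_right_inverse_on[OF f V.subspace_UNIV] by blast
    have Th: "T (h (f x)) = T x" for x
      using T(2)[of "h (f x) - x"] h(2) by (simp add: f.diff T.diff)
    have "(\<forall>y\<in>range f. g y = (T \<circ> h) y) \<longleftrightarrow> g \<circ> f = T" for g
      using Th by (auto simp: fun_eq_iff)
    then have "{g \<in> ?G. g \<circ> f = T} =
        {g. Vector_Spaces.linear s2 s1 g \<and> range g \<subseteq> UNIV \<and> (\<forall>y\<in>W.span (range f). g y = (T \<circ> h) y)}"
      using T(3) f.subspace_image[OF V.subspace_UNIV]
      by (auto simp only: W.span_eq_iff[THEN iffD2] mem_Collect_eq subset_UNIV simp_thms)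
    also have "card \<dots> = card (UNIV :: 'v set) ^ (?n - ?r)"
      by (rule opp.card_linear_extensions[OF Vector_Spaces.linear_compose[OF h(1) T(1)]]) auto
    finally show "card {g \<in> ?G. g \<circ> f = T} = ?q ^ (?m * (?n - ?r))"
      using V.card_subspace[OF V.subspace_UNIV] by (simp add: power_mult)
  qed
  finally have "card ?G * ?q ^ ?r = card E * ?q ^ ?r * ?q ^ (?m * (?n - ?r))" by simp
  also have "\<dots> = ?q ^ (?m * ?n)"
    unfolding cE using rn by (simp add: power_add[symmetric] add_mult_distrib2[symmetric])
  finally show ?thesis .
qed

lemma card_nilpotent_pairs:
  assumes q: "CARD('k) = q" and m: "V.dim UNIV = m" and n: "W.dim UNIV = n"
  shows "(of_nat (card {(f, g). nilpotent_pair s1 s2 f g}) :: rat) =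
    (\<Sum>r = 0..min m n. q_binomial q m r * q_binomial q n r *
       of_nat q ^ (m * n - r) * (\<Prod>i<r. of_nat q ^ r - of_nat q ^ i))"
proof -
  interpret opp: finite_vector_space_pair s2 B2 s1 B1 ..
  let ?G = "\<lambda>f. {g. Vector_Spaces.linear s2 s1 g \<and> nilpotent_map (g \<circ> f)}"
  let ?F = "\<lambda>r. {f. lin f \<and> rank f = r}"
  let ?p = "\<lambda>k r. \<Prod>i<r. (of_nat q :: rat) ^ k - of_nat q ^ i"
  have q1: "1 < q" using one_less_q q by simp
  have rank_le: "rank f \<le> min m n" if "lin f" for f
    using rank_plus_nullity[OF that] W.dim_le[of "range f"] m n by simp
  have p: "of_nat (\<Prod>i<r. q ^ k - q ^ i) = ?p k r" if "r \<le> k" for k r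
    unfolding of_nat_prod using that q1 by (intro prod.cong refl) (simp add: of_nat_diff)
  have p_nz: "?p r r \<noteq> 0" for r
    using q1 power_strict_increasing[of _ r "of_nat q :: rat"] by (fastforce simp: prod_zero_iff)
  have G: "of_nat (card (?G f)) = (of_nat q :: rat) ^ (m * n - rank f)" if "lin f" for f
  proof -
    have "rank f \<le> m * n"
    proof (cases n)
      case (Suc k)
      then show ?thesis using rank_le[OF that] by (simp add: trans_le_add1)
    qed (use rank_le[OF that] in simp)
    then have "card (?G f) * q ^ rank f = q ^ (m * n - rank f) * q ^ rank f"
      using card_nilpotent_partners[OF that] q m n by (simp add: power_add[symmetric])
    then have "card (?G f) = q ^ (m * n - rank f)" using q1 by simp
    then show ?thesis by simp
  qed
  have F: "of_nat (card (?F r)) = q_binomial q m r * q_binomial q n r * ?p r r"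
    if "r \<le> min m n" for r
  proof -
    have "card (?F r) * (\<Prod>i<r. q ^ r - q ^ i) = (\<Prod>i<r. q ^ m - q ^ i) * (\<Prod>i<r. q ^ n - q ^ i)"
      using card_linear_of_rank[of r] that q m n by simp
    moreover have "?p r r = of_nat (\<Prod>i<r. q ^ r - q ^ i)"
      "?p m r = of_nat (\<Prod>i<r. q ^ m - q ^ i)" "?p n r = of_nat (\<Prod>i<r. q ^ n - q ^ i)"
      using p[of r r] p[of r m] p[of r n] that by simp_all
    ultimately have "of_nat (card (?F r)) * ?p r r = ?p m r * ?p n r"
      by (simp only: of_nat_mult[symmetric])
    then show ?thesis using p_nz[of r] by (simp add: q_binomial_def field_simps)
  qed
  have "{(f, g). nilpotent_pair s1 s2 f g} = Sigma {f. lin f} ?G"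
    by (auto simp: nilpotent_pair_def)
  then have "(of_nat (card {(f, g). nilpotent_pair s1 s2 f g}) :: rat) =
      (\<Sum>f | lin f. of_nat (card (?G f)))"
    by (simp add: card_SigmaI)
  also have "\<dots> = (\<Sum>r = 0..min m n. \<Sum>f | lin f \<and> rank f = r. of_nat (card (?G f)))"
    using sum.group[of "{f. lin f}" "{0..min m n}" rank "\<lambda>f. of_nat (card (?G f)) :: rat"] rank_le
    by (simp add: image_subset_iff)
  also have "\<dots> = (\<Sum>r = 0..min m n. of_nat (card (?F r)) * of_nat q ^ (m * n - r))"
    using G by simp
  also have "\<dots> = (\<Sum>r = 0..min m n. q_binomial q m r * q_binomial q n r *
       of_nat q ^ (m * n - r) * ?p r r)"
    using F by (intro sum.cong) (simp_all add: mult_ac)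
  finally show ?thesis .
qed

end

theorem theorem4p8:
  fixes scaleV :: "'k::{field, finite} \<Rightarrow> 'v::ab_group_add \<Rightarrow> 'v"
    and scaleW :: "'k \<Rightarrow> 'w::ab_group_add \<Rightarrow> 'w"
    and BV :: "'v set" and BW :: "'w set"
    and q m n :: nat
  assumes "primepow q" and "card (UNIV :: 'k set) = q"
    and "finite_dimensional_vector_space scaleV BV"
    and "finite_dimensional_vector_space scaleW BW"
    and "vector_space.dim scaleV (UNIV :: 'v set) = m"
    and "vector_space.dim scaleW (UNIV :: 'w set) = n"
  shows "(of_nat (card {(f, g). nilpotent_pair scaleV scaleW f g}) :: rat) =
    (\<Sum>r = 0..min m n. q_binomial q m r * q_binomial q n r *
       of_nat q ^ (m * n - r) * (\<Prod>i<r. of_nat q ^ r - of_nat q ^ i))"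
proof -
  interpret finite_vector_space_pair scaleV BV scaleW BW
    using assms(3,4) by (simp add: finite_vector_space_pair_def finite_vector_space_def)
  show ?thesis using card_nilpotent_pairs assms(2,5,6) .
qed

end
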